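(* Let $P$ be a poset such that $P_0$ is locally finite, and let $u,w\in P^*$ with $u\le w$ in generalized subword order. Then \[ \mu(u,w)=\sum_{\eta}\ \prod_{1\le j\le |w|}\begin{cases}\mu_0(\eta(j),w(j))+1 & \text{if } \eta(j)=0 \text{ and } w(j-1)=w(j),\\ \mu_0(\eta(j),w(j)) & \text{otherwise,}\end{cases} \] where the sum is over all embeddings $\eta$ of $u$ in $w$, and for $j=1$ the condition $w(j-1)=w(j)$ is considered false.
   Context: $P_0$ denotes the poset $P$ with a new bottom element $0$ adjoined; $\le_0$ and $\mu_0$ are its order relation and Möbius function. $P^*$ is the set of all finite words $w=w(1)w(2)\cdots w(n)$ ($n\ge 0$, including the empty word) with letters in $P$; $|w|$ is the length. Generalized subword order on $P^*$: $u\le w$ iff there are indices $i_1<i_2<\dots<i_k$ with $k=|u|$ and $u(j)\le_P w(i_j)$ for $1\le j\le k$. $\mu$ denotes the Möbius function of $P^*$. An expansion of $u\in P^*$ is a word $\eta$ over $P_0$ whose subsequence of nonzero letters is $u$. An embedding of $u$ in $w$ is an expansion $\eta$ of $u$ with $|\eta|=|w|$ and $\eta(j)\le_0 w(j)$ for all $j$. *)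

theory Defs
  imports "HOL-Library.Sublist" "HOL-Library.Option_ord"
begin

text \<open>
  The guard \<open>finite {x..z}\<close> makes the recursion terminate in an arbitrary poset. In a locally finite
  poset it is vacuous; the usual recurrence is recovered in \<open>mobius_refl\<close>, \<open>mobius_rec\<close> and
  \<open>mobius_not_le\<close> below.
\<close>

function mobius :: "'a::order \<Rightarrow> 'a \<Rightarrow> int" where
  "mobius x z =
    (if x = z then 1
     else if x < z \<and> finite {x..z} then - (\<Sum>y\<in>{x..<z}. mobius x y)
     else 0)"
  by auto
termination
proof (relation "measure (\<lambda>(x, z). card {x..z})", goal_cases)
  case (2 x z y)
  then have "{x..y} \<subseteq> {x..z}" "z \<in> {x..z}" "z \<notin> {x..y}"
    by auto
  then have "{x..y} \<subset> {x..z}"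
    by blast
  with 2 show ?case
    by (auto intro: psubset_card_mono)
qed simp

declare mobius.simps [simp del]

lemma mobius_refl: "mobius x x = 1"
  by (simp add: mobius.simps)

lemma mobius_rec:
  assumes "x < z" "finite {x..z}"
  shows "mobius x z = - (\<Sum>y\<in>{x..<z}. mobius x y)"
  using assms by (subst mobius.simps) auto

lemma mobius_not_le: "\<not> x \<le> z \<Longrightarrow> mobius x z = 0"
  by (subst mobius.simps) (auto simp: less_le)

text \<open>
  Generalized subword order on words over a poset; see \<open>word_le_iff\<close> for the description in terms
  of increasing positions.
\<close>

instantiation list :: (order) order
begin

definition less_eq_list :: "'a list \<Rightarrow> 'a list \<Rightarrow> bool" where
  "u \<le> w \<longleftrightarrow> list_emb (\<le>) u w"

definition less_list :: "'a list \<Rightarrow> 'a list \<Rightarrow> bool" where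
  "u < w \<longleftrightarrow> u \<le> w \<and> \<not> w \<le> (u :: 'a list)"

instance
proof
  fix u v w :: "'a list"
  show "u < w \<longleftrightarrow> u \<le> w \<and> \<not> w \<le> u"
    by (rule less_list_def)
  show "u \<le> u"
    by (simp add: less_eq_list_def list_emb_refl)
  show "u \<le> w" if "u \<le> v" "v \<le> w"
    using that unfolding less_eq_list_def by (rule list_emb_trans[rotated]) auto
  show "u = v" if "u \<le> v" "v \<le> u"
  proof -
    have len: "length u = length v"
      using that by (auto simp: less_eq_list_def intro: antisym list_emb_length)
    have "list_emb (\<le>) u v \<Longrightarrow> length u = length v \<Longrightarrow> list_all2 (\<le>) u v" for u v :: "'a list"
      by (induction rule: list_emb.induct) (auto dest: list_emb_length)
    then have "list_all2 (\<le>) u v" "list_all2 (\<le>) v u"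
      using that len by (auto simp: less_eq_list_def)
    then show "u = v"
      by (auto simp: list_all2_conv_all_nth intro!: nth_equalityI antisym)
  qed
qed

end

lemma word_le_iff:
  fixes u w :: "'a::order list"
  shows "u \<le> w \<longleftrightarrow> (\<exists>i :: nat \<Rightarrow> nat. strict_mono_on {..<length u} i \<and>
           (\<forall>j<length u. i j < length w \<and> u ! j \<le> w ! i j))"
    (is "_ \<longleftrightarrow> ?R u w")
proof
  assume "u \<le> w"
  then have "list_emb (\<le>) u w"
    by (simp add: less_eq_list_def)
  then show "?R u w"
  proof (induction rule: list_emb.induct)
    case (list_emb_Nil ys)
    then show ?case by simp
  next
    case (list_emb_Cons xs ys y)
    then obtain i :: "nat \<Rightarrow> nat" where "strict_mono_on {..<length xs} i"
      "\<forall>j<length xs. i j < length ys \<and> xs ! j \<le> ys ! i j" by blast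
    then show ?case
      by (intro exI[of _ "Suc \<circ> i"]) (auto simp: strict_mono_on_def)
  next
    case (list_emb_Cons2 x y xs ys)
    then obtain i :: "nat \<Rightarrow> nat" where "strict_mono_on {..<length xs} i"
      "\<forall>j<length xs. i j < length ys \<and> xs ! j \<le> ys ! i j" by blast
    with \<open>x \<le> y\<close> show ?case
      by (intro exI[of _ "case_nat 0 (Suc \<circ> i)"])
         (auto simp: strict_mono_on_def nth_Cons split: nat.splits)
  qed
next
  assume "?R u w"
  then have "list_emb (\<le>) u w"
  proof (induction w arbitrary: u)
    case Nil
    then show ?case by auto
  next
    case (Cons y w)
    then obtain i :: "nat \<Rightarrow> nat" where mono: "strict_mono_on {..<length u} i"
      and le: "\<And>j. j < length u \<Longrightarrow> i j < Suc (length w) \<and> u ! j \<le> (y # w) ! i j" by auto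
    show ?case
    proof (cases u)
      case Nil
      then show ?thesis by simp
    next
      case u: (Cons x v)
      have pos: "i (Suc j) > 0" if "j < length v" for j
        using strict_mono_onD[OF mono, of 0 "Suc j"] that u by auto
      have R_v: "?R v w"
      proof (intro exI[of _ "\<lambda>j. i (Suc j) - 1"] conjI strict_mono_onI allI impI)
        fix j k assume "j \<in> {..<length v}" "k \<in> {..<length v}" "j < k"
        then show "i (Suc j) - 1 < i (Suc k) - 1"
          using strict_mono_onD[OF mono, of "Suc j" "Suc k"] pos[of j] u by auto
      next
        fix j assume "j < length v"
        then show "i (Suc j) - 1 < length w" "v ! j \<le> w ! (i (Suc j) - 1)"
          using le[of "Suc j"] pos[of j] u by auto
      qed
      show ?thesis
      proof (cases "i 0 = 0")
        case True
        with le[of 0] u have "x \<le> y" by simp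
        then show ?thesis
          using Cons.IH[OF R_v] u by auto
      next
        case False
        have pos': "i j > 0" if "j < length u" for j
          using False pos that u by (cases j) auto
        have "?R u w"
        proof (intro exI[of _ "\<lambda>j. i j - 1"] conjI strict_mono_onI allI impI)
          fix j k assume "j \<in> {..<length u}" "k \<in> {..<length u}" "j < k"
          then show "i j - 1 < i k - 1"
            using strict_mono_onD[OF mono, of j k] pos'[of j] by auto
        next
          fix j assume "j < length u"
          then show "i j - 1 < length w" "u ! j \<le> w ! (i j - 1)"
            using le[of j] pos'[of j] by auto
        qed
        then show ?thesis
          using Cons.IH by blast
      qed
    qed
  qed
  then show "u \<le> w"
    by (simp add: less_eq_list_def)
qed

text \<open>
  The poset with a new bottom element adjoined is \<^typ>\<open>'a option\<close> with the order of
  \<open>HOL-Library.Option_ord\<close>, in which \<^const>\<open>None\<close> is the new bottom.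
\<close>

definition expansions :: "'a list \<Rightarrow> 'a option list set" where
  "expansions u = {\<eta>. filter (\<lambda>a. a \<noteq> None) \<eta> = map Some u}"

definition embeddings :: "'a::order list \<Rightarrow> 'a list \<Rightarrow> 'a option list set" where
  "embeddings u w =
    {\<eta> \<in> expansions u. length \<eta> = length w \<and> (\<forall>j<length w. \<eta> ! j \<le> Some (w ! j))}"

end

theory Submission
  imports Defs
begin

text \<open>
  Instead of the recurrence for \<open>\<mu>(u, _)\<close>, the right-hand side is checked against the dual recurrence
  for \<open>\<mu>(_, w)\<close>: summing it over \<open>v \<in> {u..w}\<close> merges the embeddings of all \<open>v\<close> into the words
  \<open>\<eta> \<le>\<^sub>0 w\<close> whose nonzero part lies above \<open>u\<close>. Membership of \<open>\<eta>\<close> is decided by greedy matching from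
  the left, so the sum satisfies a recursion in the first letters of \<open>u\<close> and \<open>w\<close>, where \<open>\<mu>\<^sub>0\<close>
  enters only through \<open>\<Sum>e\<in>{a..x}. \<mu>\<^sub>0 e x\<close>, which is \<open>1\<close> if \<open>a = x\<close> and \<open>0\<close> otherwise. If a letter
  \<open>p\<close> is imagined in front of \<open>w\<close>, the solution of the recursion is the indicator of
  \<open>w = p ... p u\<close>; without a preceding letter it is the indicator of \<open>w = u\<close>.
\<close>

section \<open>Moebius inversion and the dual recurrence on finite intervals\<close>

lemma sum_mobius:
  fixes x z :: "'a::order"
  assumes "finite {x..z}"
  shows "(\<Sum>y\<in>{x..z}. mobius x y) = (if x = z then 1 else 0)"
proof (cases "x < z")
  case True
  then have "{x..z} = insert z {x..<z}" by auto
  moreover have "finite {x..<z}"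
    using assms by (rule finite_subset[rotated]) auto
  ultimately show ?thesis
    using True mobius_rec[OF True assms] by simp
next
  case False
  then show ?thesis
    by (cases "x = z") (auto simp: mobius_refl less_le)
qed

text \<open>After exchanging the two sums, the coefficient of \<open>f t\<close> is the sum of
  \<open>mobius x y\<close> over \<open>{x..t}\<close>, which vanishes unless
  \<open>t = x\<close>.\<close>

lemma mobius_inversion:
  fixes x z :: "'a::order"
  assumes fin: "finite {x..z}" and le: "x \<le> z"
  shows "(\<Sum>y\<in>{x..z}. mobius x y * (\<Sum>t\<in>{y..z}. f t)) = f x"
proof -
  have "(\<Sum>y\<in>{x..z}. mobius x y * (\<Sum>t\<in>{y..z}. f t)) =
      (\<Sum>y\<in>{x..z}. \<Sum>t | t \<in> {x..z} \<and> y \<le> t. mobius x y * f t)"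
    unfolding sum_distrib_left by (intro sum.cong) auto
  also have "\<dots> = (\<Sum>t\<in>{x..z}. \<Sum>y | y \<in> {x..z} \<and> y \<le> t. mobius x y * f t)"
    by (rule sum.swap_restrict[OF fin fin])
  also have "\<dots> = (\<Sum>t\<in>{x..z}. (\<Sum>y\<in>{x..t}. mobius x y) * f t)"
    unfolding sum_distrib_right by (intro sum.cong) auto
  also have "\<dots> = (\<Sum>t\<in>{x..z}. if x = t then f t else 0)"
  proof (intro sum.cong refl)
    fix t assume "t \<in> {x..z}"
    then have "finite {x..t}"
      by (intro finite_subset[OF _ fin]) auto
    then show "(\<Sum>y\<in>{x..t}. mobius x y) * f t = (if x = t then f t else 0)"
      by (simp add: sum_mobius)
  qed
  also have "\<dots> = f x"
    using fin le by (simp add: sum.delta')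
  finally show ?thesis .
qed

lemma mobius_unique:
  fixes x z :: "'a::order"
  assumes fin: "finite {x..z}" and le: "x \<le> z"
    and f: "\<And>y. y \<in> {x..z} \<Longrightarrow> (\<Sum>t\<in>{y..z}. f t) = (if y = z then 1 else 0)"
  shows "f x = mobius x z"
proof -
  have "f x = (\<Sum>y\<in>{x..z}. mobius x y * (if y = z then 1 else 0))"
    unfolding mobius_inversion[OF fin le, of f, symmetric] by (intro sum.cong) (auto simp: f)
  also have "\<dots> = (\<Sum>y\<in>{x..z}. if y = z then mobius x y else 0)"
    by (intro sum.cong) auto
  also have "\<dots> = mobius x z"
    using fin le by (simp add: sum.delta)
  finally show ?thesis .
qed

text \<open>The definition of \<open>mobius\<close> recurses on the upper argument only, so the
  recurrence in the lower argument has to be derived; inversion links the two.\<close>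

lemma sum_mobius_dual:
  fixes x z :: "'a::order"
  assumes "finite {x..z}"
  shows "(\<Sum>y\<in>{x..z}. mobius y z) = (if x = z then 1 else 0)"
  using assms
proof (induction "card {x..z}" arbitrary: x rule: less_induct)
  case less
  show ?case
  proof (cases "x < z")
    case True
    define g where "g y = (\<Sum>t\<in>{y..z}. mobius t z)" for y
    have g: "g y = (if y = z then 1 else 0)" if "y \<in> {x<..z}" for y
    proof -
      have "{y..z} \<subset> {x..z}"
        using that True by auto
      then show ?thesis
        unfolding g_def by (metis less finite_subset psubset_imp_subset psubset_card_mono)
    qed
    have split: "{x..z} = insert x {x<..z}"
      using True by auto
    have fin: "finite {x<..z}"
      using less.prems split by simp
    \<comment> \<open>By induction \<open>g\<close> is already the indicator of \<open>z\<close>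
      above \<open>x\<close>, so inversion reads \<open>mobius x z = g x + mobius x z\<close> and
      forces \<open>g x = 0\<close>.\<close>
    have "mobius x z = (\<Sum>y\<in>{x..z}. mobius x y * g y)"
      using mobius_inversion[OF less.prems, of "\<lambda>t. mobius t z"] True by (simp add: g_def)
    also have "\<dots> = g x + (\<Sum>y\<in>{x<..z}. mobius x y * g y)"
      using fin by (simp add: split mobius_refl)
    also have "(\<Sum>y\<in>{x<..z}. mobius x y * g y) = (\<Sum>y\<in>{x<..z}. if y = z then mobius x y else 0)"
      by (intro sum.cong) (auto simp: g)
    also have "\<dots> = mobius x z"
      using fin True by (simp add: sum.delta)
    finally show ?thesis
      using True by (auto simp: g_def)
  next
    case False
    then show ?thesis
      by (cases "x = z") (auto simp: mobius_refl less_le)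
  qed
qed

text \<open>A word below \<open>x # w\<close> either lies below \<open>w\<close> or is a letter
  below \<open>x\<close> followed by a word below \<open>w\<close>.\<close>

lemma finite_words_below:
  fixes w :: "'a::order list"
  assumes fin: "\<And>x::'a. finite {..x}"
  shows "finite {..w}"
proof (induction w)
  case Nil
  have "{..[] :: 'a list} = {[]}"
    by (auto simp: less_eq_list_def)
  then show ?case by simp
next
  case (Cons x w)
  have "{..x # w} \<subseteq> {..w} \<union> (\<lambda>(a, v). a # v) ` ({..x} \<times> {..w})"
    by (auto simp: less_eq_list_def image_iff atMost_def elim!: list_emb.cases[of _ _ "x # w"] intro: list_emb_Nil)
  then show ?case
    by (rule finite_subset) (intro finite_UnI finite_imageI finite_cartesian_product Cons fin)
qed

section \<open>Words over the extended poset below a given word, and their weights\<close>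

definition bounded_words :: "'a::order list \<Rightarrow> 'a option list set" where
  "bounded_words w = {\<eta>. list_all2 (\<le>) \<eta> (map Some w)}"

definition nonzero_part :: "'a option list \<Rightarrow> 'a list" where
  "nonzero_part = List.map_filter (\<lambda>e. e)"

text \<open>The parameter \<open>p\<close> stands for the letter before \<open>w\<close>, which lets
  the weight recurse on tails of \<open>w\<close>; \<open>p = None\<close> equals no
  \<open>Some\<close> letter and so encodes the convention at the first position.\<close>

definition weight :: "'a::order option \<Rightarrow> 'a option list \<Rightarrow> 'a list \<Rightarrow> int" where
  "weight p \<eta> w = (\<Prod>j<length w. mobius (\<eta> ! j) (Some (w ! j)) +
     (if \<eta> ! j = None \<and> (p # map Some w) ! j = Some (w ! j) then 1 else 0))"

lemma bounded_words_Nil [simp]: "bounded_words [] = {[]}"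
  by (auto simp: bounded_words_def)

lemma bounded_words_Cons:
  "bounded_words (x # w) = (\<lambda>(e, \<eta>). e # \<eta>) ` ({..Some x} \<times> bounded_words w)"
  by (auto simp: bounded_words_def list_all2_Cons2)

lemma finite_bounded_words:
  fixes w :: "'a::order list"
  assumes "\<And>e::'a option. finite {..e}"
  shows "finite (bounded_words w)"
  by (induction w) (simp_all add: bounded_words_Cons assms)

lemma nonzero_part_simps [simp]:
  "nonzero_part [] = []"
  "nonzero_part (None # \<eta>) = nonzero_part \<eta>"
  "nonzero_part (Some a # \<eta>) = a # nonzero_part \<eta>"
  by (simp_all add: nonzero_part_def List.map_filter_def)

lemma nonzero_part_le:
  "\<eta> \<in> bounded_words w \<Longrightarrow> nonzero_part \<eta> \<le> w"
proof (induction w arbitrary: \<eta>)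
  case (Cons x w)
  then obtain e \<eta>' where "\<eta> = e # \<eta>'" "e \<le> Some x" "\<eta>' \<in> bounded_words w"
    by (auto simp: bounded_words_Cons)
  with Cons.IH[of \<eta>'] show ?case
    by (cases e) (auto simp: less_eq_list_def)
qed simp

lemma expansions_conv_nonzero_part: "\<eta> \<in> expansions v \<longleftrightarrow> nonzero_part \<eta> = v"
proof -
  have "filter (\<lambda>a. a \<noteq> None) \<eta> = map Some (nonzero_part \<eta>)"
  proof (induction \<eta>)
    case (Cons e \<eta>)
    then show ?case by (cases e) auto
  qed simp
  then show ?thesis
    by (auto simp: expansions_def inj_map_eq_map)
qed

lemma embeddings_conv: "embeddings v w = {\<eta> \<in> bounded_words w. nonzero_part \<eta> = v}"
  by (auto simp: embeddings_def bounded_words_def expansions_conv_nonzero_part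
      list_all2_conv_all_nth)

lemma weight_Nil [simp]: "weight p [] [] = 1"
  by (simp add: weight_def)

lemma weight_Cons:
  "weight p (e # \<eta>) (x # w) =
     (mobius e (Some x) + (if e = None \<and> p = Some x then 1 else 0)) * weight (Some x) \<eta> w"
  by (simp add: weight_def prod.lessThan_Suc_shift del: prod.lessThan_Suc)

text \<open>Greedy matching: a letter above \<open>a\<close> may always be used to match \<open>a\<close>.\<close>

lemma Cons_le_nonzero_part_Cons:
  fixes a :: "'a::order"
  shows "a # u \<le> nonzero_part (e # \<eta>) \<longleftrightarrow>
    (if Some a \<le> e then u \<le> nonzero_part \<eta> else a # u \<le> nonzero_part \<eta>)"
proof (cases e)
  case (Some b)
  \<comment> \<open>If \<open>a\<close> is matched only after \<open>b\<close>, then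
    \<open>u\<close> still embeds in the rest, so matching \<open>a\<close> with \<open>b\<close>
    loses nothing.\<close>
  have "list_emb (\<le>) u v" if "list_emb (\<le>) (a # u) v" for v
    using that by (rule list_emb_ConsD[THEN exE]) (auto intro: list_emb_append2)
  then show ?thesis
    using Some by (auto simp: less_eq_list_def elim: list_emb.cases)
qed simp

section \<open>Recursion for the weight sum in the first letters\<close>

definition weight_sum :: "'a::order option \<Rightarrow> 'a list \<Rightarrow> 'a list \<Rightarrow> int" where
  "weight_sum p u w = (\<Sum>\<eta>\<in>bounded_words w. if u \<le> nonzero_part \<eta> then weight p \<eta> w else 0)"

lemma Nil_le_list [simp]: "[] \<le> (w :: 'a::order list)"
  by (simp add: less_eq_list_def)

lemma sum_mobius_atMost_Some:
  assumes "\<And>e::'a::order option. finite {..e}"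
  shows "(\<Sum>e\<in>{..Some x}. mobius e (Some x :: 'a option)) = 0"
proof -
  have "{..Some x} = {None..Some x}" by auto
  then show ?thesis
    using sum_mobius_dual[of None "Some x"] assms[of "Some x"] by simp
qed

lemma sum_bounded_words_Cons:
  "(\<Sum>\<eta>\<in>bounded_words (x # w). f \<eta>) = (\<Sum>e\<in>{..Some x}. \<Sum>\<eta>\<in>bounded_words w. f (e # \<eta>))"
proof -
  have "inj_on (\<lambda>(e, \<eta>). e # \<eta>) ({..Some x} \<times> bounded_words w)"
    by (auto simp: inj_on_def)
  then show ?thesis
    by (simp add: bounded_words_Cons sum.reindex sum.cartesian_product case_prod_unfold)
qed

text \<open>The empty word imposes no condition, so the sum over the first letter splits off as a
  factor. Its Moebius part cancels, leaving only the extra 1 at \<open>None\<close>.\<close>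

lemma weight_sum_Nil_Cons:
  fixes x :: "'a::order"
  assumes fin: "\<And>e::'a option. finite {..e}"
  shows "weight_sum p [] (x # w) = (if p = Some x then weight_sum (Some x) [] w else 0)"
proof -
  have "weight_sum p [] (x # w) =
      (\<Sum>e\<in>{..Some x}. mobius e (Some x) + (if e = None \<and> p = Some x then 1 else 0)) *
      weight_sum (Some x) [] w"
    by (simp add: weight_sum_def sum_bounded_words_Cons weight_Cons sum_product)
  also have "(\<Sum>e\<in>{..Some x}. mobius e (Some x) + (if e = None \<and> p = Some x then 1 else 0)) =
      (\<Sum>e\<in>{..Some x}. if e = None then if p = Some x then 1 else 0 else 0 :: int)"
    using sum_mobius_atMost_Some[OF fin, of x] by (auto simp: sum.distrib intro!: sum.cong)
  also have "\<dots> = (if p = Some x then 1 else 0)"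
    using fin by (simp add: sum.delta)
  finally show ?thesis by simp
qed

text \<open>By greedy matching, a first letter in \<open>A\<close> (those above \<open>a\<close>)
  uses up \<open>a\<close>, while one in \<open>B\<close> leaves \<open>a # u\<close> to be matched.
  The coefficient for \<open>B\<close> is the total minus the one for \<open>A\<close>.\<close>

lemma weight_sum_Cons_Cons:
  fixes x a :: "'a::order"
  assumes fin: "\<And>e::'a option. finite {..e}"
  shows "weight_sum p (a # u) (x # w) =
    (if a = x then weight_sum (Some x) u w else 0) +
    ((if p = Some x then 1 else 0) - (if a = x then 1 else 0)) * weight_sum (Some x) (a # u) w"
proof -
  define A where "A = {Some a..Some x}"
  define B where "B = {..Some x} - A"
  define h where "h e = mobius e (Some x) + (if e = None \<and> p = Some x then 1 else 0)" for e
  have A: "A \<subseteq> {..Some x}" and None: "None \<in> B"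
    by (auto simp: A_def B_def)
  have finA: "finite A" and finB: "finite B"
    using fin A finite_subset unfolding B_def by blast+
  have hA: "sum h A = (if a = x then 1 else 0)"
  proof -
    \<comment> \<open>The extra 1 in \<open>h\<close> occurs only at \<open>None\<close>, which lies
      outside \<open>A\<close>.\<close>
    have "sum h A = (\<Sum>e\<in>A. mobius e (Some x))"
      by (intro sum.cong) (auto simp: h_def A_def)
    also have "\<dots> = (if a = x then 1 else 0)"
      using sum_mobius_dual[of "Some a" "Some x"] finA by (simp add: A_def)
    finally show ?thesis .
  qed
  have h_all: "sum h {..Some x} = (if p = Some x then 1 else 0)"
  proof -
    have "sum h {..Some x} = (\<Sum>e\<in>{..Some x}. mobius e (Some x)) +
        (\<Sum>e\<in>{..Some x}. if e = None then if p = Some x then 1 else 0 else 0)"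
      unfolding h_def sum.distrib by (auto intro!: sum.cong)
    then show ?thesis
      using fin by (simp add: sum_mobius_atMost_Some[OF fin] sum.delta)
  qed
  have hB: "sum h B = (if p = Some x then 1 else 0) - (if a = x then 1 else 0)"
    using sum_diff[OF fin A, of h] hA h_all by (simp add: B_def)
  define k where "k e = (\<Sum>\<eta>\<in>bounded_words w.
    if a # u \<le> nonzero_part (e # \<eta>) then weight p (e # \<eta>) (x # w) else 0)" for e
  have kA: "k e = h e * weight_sum (Some x) u w" if "e \<in> A" for e
    using that unfolding k_def weight_sum_def sum_distrib_left
    by (intro sum.cong) (auto simp: Cons_le_nonzero_part_Cons weight_Cons h_def A_def)
  have kB: "k e = h e * weight_sum (Some x) (a # u) w" if "e \<in> B" for e
    using that unfolding k_def weight_sum_def sum_distrib_left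
    by (intro sum.cong) (auto simp: Cons_le_nonzero_part_Cons weight_Cons h_def A_def B_def)
  have "weight_sum p (a # u) (x # w) = sum k {..Some x}"
    by (simp add: weight_sum_def sum_bounded_words_Cons k_def)
  also have "\<dots> = sum k B + sum k A"
    unfolding B_def by (rule sum.subset_diff[OF A fin])
  also have "\<dots> = sum h B * weight_sum (Some x) (a # u) w + sum h A * weight_sum (Some x) u w"
    unfolding sum_distrib_right by (simp add: kA kB)
  finally show ?thesis
    by (simp add: hA hB)
qed

section \<open>The relation w = p ... p u, whose indicator solves the recursion\<close>

inductive pads :: "'a option \<Rightarrow> 'a list \<Rightarrow> 'a list \<Rightarrow> bool" for p u where
  pads_refl: "pads p u u"
| pads_Cons: "p = Some x \<Longrightarrow> pads p u w \<Longrightarrow> pads p u (x # w)"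

lemma pads_Nil_right_iff [simp]: "pads p u [] \<longleftrightarrow> u = []"
  by (auto intro: pads_refl elim: pads.cases)

lemma pads_Cons_right_iff: "pads p u (x # w) \<longleftrightarrow> u = x # w \<or> p = Some x \<and> pads p u w"
  by (auto intro: pads.intros elim: pads.cases)

lemma pads_None_iff [simp]: "pads None u w \<longleftrightarrow> u = w"
  by (auto intro: pads_refl elim: pads.cases)

lemma pads_length: "pads p u w \<Longrightarrow> length u \<le> length w"
  by (induction rule: pads.induct) auto

text \<open>Moving one \<open>x\<close> into the base word requires at least one padding letter,
  which excludes exactly \<open>w = u\<close>.\<close>

lemma pads_Cons_same_iff: "pads (Some x) (x # u) w \<longleftrightarrow> w \<noteq> u \<and> pads (Some x) u w"
proof (induction w)
  case (Cons y w)
  then show ?case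
    using pads_length[of "Some x" "y # w" w] by (auto simp: pads_Cons_right_iff intro: pads_refl)
qed auto

lemma weight_sum_eq:
  fixes u w :: "'a::order list"
  assumes fin: "\<And>e::'a option. finite {..e}"
  shows "weight_sum p u w = (if pads p u w then 1 else 0)"
proof (induction w arbitrary: p u)
  case Nil
  show ?case
    by (cases u) (auto simp: weight_sum_def less_eq_list_def)
next
  case (Cons x w)
  show ?case
  proof (cases u)
    case Nil
    then show ?thesis
      by (auto simp: weight_sum_Nil_Cons[OF fin] Cons.IH pads_Cons_right_iff)
  next
    case (Cons a u')
    \<comment> \<open>For \<open>a = x\<close> the terms without \<open>p\<close> are the indicator
      of w = x ... x u' minus that of w = x ... x x u', hence that of \<open>w = u'\<close>. The
      case \<open>p = Some x\<close> adds the subtracted indicator back.\<close>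
    then show ?thesis
      by (auto simp: weight_sum_Cons_Cons[OF fin] Cons.IH pads_Cons_right_iff pads_Cons_same_iff
          intro: pads_refl)
  qed
qed

theorem theorem1p1:
  fixes u w :: "'a::order list"
  assumes "\<And>x y :: 'a option. finite {x..y}"
    and "u \<le> w"
  shows "mobius u w =
    (\<Sum>\<eta>\<in>embeddings u w. \<Prod>j<length w.
       if \<eta> ! j = None \<and> 0 < j \<and> w ! (j - 1) = w ! j
       then mobius (\<eta> ! j) (Some (w ! j)) + 1
       else mobius (\<eta> ! j) (Some (w ! j)))"
proof -
  have fin: "finite {..e}" for e :: "'a option"
    using assms(1)[of None e] by (rule finite_subset[rotated]) auto
  have "finite {..x}" for x :: 'a
    using fin[of "Some x"] by (rule inj_on_finite[of Some, rotated 2]) auto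
  then have fin_words: "finite {..w}"
    by (rule finite_words_below)
  have fin_w: "finite {v..w}" for v
    using fin_words by (rule finite_subset[rotated]) auto
  \<comment> \<open>The right-hand side as a function of the lower word, to be tested against the
    dual recurrence.\<close>
  define f where "f v = (\<Sum>\<eta>\<in>embeddings v w. weight None \<eta> w)" for v
  have sum_f: "(\<Sum>t\<in>{v..w}. f t) = (if v = w then 1 else 0)" for v
  proof -
    let ?S = "{\<eta> \<in> bounded_words w. v \<le> nonzero_part \<eta>}"
    have "(\<Sum>t\<in>{v..w}. f t) =
        (\<Sum>t\<in>{v..w}. \<Sum>\<eta> | \<eta> \<in> ?S \<and> nonzero_part \<eta> = t. weight None \<eta> w)"
      unfolding f_def embeddings_conv by (intro sum.cong) auto
    \<comment> \<open>The embeddings of \<open>t\<close> are the fibre of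
      \<open>nonzero_part\<close> over \<open>t\<close>; for \<open>\<eta>\<close> in
      \<open>?S\<close> the nonzero part lies in \<open>{v..w}\<close>, so these fibres partition
      \<open>?S\<close>.\<close>
    also have "\<dots> = (\<Sum>\<eta>\<in>?S. weight None \<eta> w)"
      using fin_w finite_bounded_words[OF fin] by (intro sum.group) (auto simp: nonzero_part_le)
    also have "\<dots> = weight_sum None v w"
      using finite_bounded_words[OF fin] by (simp add: weight_sum_def sum.inter_filter)
    finally show ?thesis
      by (simp add: weight_sum_eq[OF fin])
  qed
  have "mobius u w = f u"
    using mobius_unique[OF fin_w assms(2), of f] sum_f by simp
  also have "\<dots> = (\<Sum>\<eta>\<in>embeddings u w. \<Prod>j<length w.
       if \<eta> ! j = None \<and> 0 < j \<and> w ! (j - 1) = w ! j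
       then mobius (\<eta> ! j) (Some (w ! j)) + 1
       else mobius (\<eta> ! j) (Some (w ! j)))"
    \<comment> \<open>Prepending \<open>None\<close> shifts indices by one: position
      \<open>j\<close> of \<open>None # map Some w\<close> holds \<open>w ! (j - 1)\<close> for
      \<open>j > 0\<close>, and \<open>None\<close> makes the test fail at 0.\<close>
    unfolding f_def weight_def by (intro sum.cong prod.cong) (auto simp: nth_Cons split: nat.splits)
  finally show ?thesis .
qed

end
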